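(* Let $\alpha>0$ and let $\varphi$ be an entire function on $\mathbb{C}$. Then for every $p>1$ and every $r\geq1$, the composition operator $C_{\varphi}f:=f\circ\varphi$ is $r$-summing on $F^p_{\alpha}$ if and only if $\varphi(z)=az+b$ for some $a,b\in\mathbb{C}$ with $|a|<1$.
   Context: $F^p_\alpha$ is the standard Fock space of entire functions $f$ with $\|f\|^p_{F^p_{\alpha}}:=\int_{\mathbb{C}}|f(z)|^pe^{-\frac{p\alpha}{2}|z|^2}dA(z)<\infty$, where $dA$ is Lebesgue measure on $\mathbb{C}$. For $r\ge1$, a linear operator $T:X\to Y$ between Banach spaces is $r$-summing if there is $C\ge0$ such that $\left(\sum_{j=1}^n\|Tx_j\|_Y^r\right)^{1/r}\le C\sup_{x^*\in B_{X^*}}\left(\sum_{j=1}^n|x^*(x_j)|^r\right)^{1/r}$ for every finite sequence $x_1,\dots,x_n\in X$ ($B_{X^*}$ the unit ball of $X^*$). "$C_\varphi$ is $r$-summing on $F^p_\alpha$" means that $C_\varphi$ maps $F^p_\alpha$ into itself and $C_\varphi:F^p_\alpha\to F^p_\alpha$ is $r$-summing. *)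

theory Defs
  imports "HOL-Complex_Analysis.Complex_Analysis"
begin

text \<open>
  The Fock spaces depend on the real parameters \<open>p\<close> and \<open>\<alpha>\<close>, so a complex normed space is
  represented by a record with an explicit set of points rather than by a type class.
\<close>

record 'a cnormed =
  points :: "'a set"
  vadd :: "'a \<Rightarrow> 'a \<Rightarrow> 'a"
  vscale :: "complex \<Rightarrow> 'a \<Rightarrow> 'a"
  vnorm :: "'a \<Rightarrow> real"

definition scalar_field :: "complex cnormed" where
  "scalar_field = \<lparr>points = UNIV, vadd = (+), vscale = (*), vnorm = cmod\<rparr>"

definition linear_operator :: "'a cnormed \<Rightarrow> 'b cnormed \<Rightarrow> ('a \<Rightarrow> 'b) \<Rightarrow> bool" where
  "linear_operator X Y T \<longleftrightarrow>
     (\<forall>x\<in>points X. T x \<in> points Y) \<and>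
     (\<forall>x\<in>points X. \<forall>y\<in>points X. T (vadd X x y) = vadd Y (T x) (T y)) \<and>
     (\<forall>c. \<forall>x\<in>points X. T (vscale X c x) = vscale Y c (T x))"

text \<open>
  The closed unit ball of the dual. Functionals are total functions, but their values outside
  \<^term>\<open>points X\<close> are never used.
\<close>

definition dual_ball :: "'a cnormed \<Rightarrow> ('a \<Rightarrow> complex) set" where
  "dual_ball X = {\<xi>. linear_operator X scalar_field \<xi> \<and> (\<forall>x\<in>points X. cmod (\<xi> x) \<le> vnorm X x)}"

definition r_summing :: "real \<Rightarrow> 'a cnormed \<Rightarrow> 'b cnormed \<Rightarrow> ('a \<Rightarrow> 'b) \<Rightarrow> bool" where
  "r_summing r X Y T \<longleftrightarrow>
     linear_operator X Y T \<and>
     (\<exists>C\<ge>0. \<forall>(n::nat) x. (\<forall>j<n. x j \<in> points X) \<longrightarrow>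
        (\<Sum>j<n. vnorm Y (T (x j)) powr r) powr (1 / r)
          \<le> C * (SUP \<xi>\<in>dual_ball X. (\<Sum>j<n. cmod (\<xi> (x j)) powr r) powr (1 / r)))"

text \<open>
  The supremum in \<^const>\<open>r_summing\<close> is taken in the reals; the next two facts show that it is
  a genuine one (of a nonempty set that is bounded above).
\<close>

lemma bdd_above_weak_sums:
  fixes n :: nat
  assumes "r \<ge> 1" "\<And>j. j < n \<Longrightarrow> x j \<in> points X"
  shows "bdd_above ((\<lambda>\<xi>. (\<Sum>j<n. cmod (\<xi> (x j)) powr r) powr (1 / r)) ` dual_ball X)"
proof (rule bdd_aboveI2)
  fix \<xi> assume "\<xi> \<in> dual_ball X"
  with assms show "(\<Sum>j<n. cmod (\<xi> (x j)) powr r) powr (1 / r)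
      \<le> (\<Sum>j<n. vnorm X (x j) powr r) powr (1 / r)"
    by (intro powr_mono2 sum_mono sum_nonneg) (auto simp: dual_ball_def)
qed

lemma zero_in_dual_ball:
  assumes "\<And>x. x \<in> points X \<Longrightarrow> 0 \<le> vnorm X x"
  shows "(\<lambda>_. 0) \<in> dual_ball X"
  using assms by (simp add: dual_ball_def linear_operator_def scalar_field_def)

definition fock_space :: "real \<Rightarrow> real \<Rightarrow> (complex \<Rightarrow> complex) cnormed" where
  "fock_space p \<alpha> =
     \<lparr>points = {f. f holomorphic_on UNIV \<and>
        integrable lborel (\<lambda>z. cmod (f z) powr p * exp (- (p * \<alpha> / 2) * (cmod z)\<^sup>2))},
      vadd = (\<lambda>f g z. f z + g z),
      vscale = (\<lambda>c f z. c * f z),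
      vnorm = (\<lambda>f. (LINT z|lborel. cmod (f z) powr p * exp (- (p * \<alpha> / 2) * (cmod z)\<^sup>2)) powr (1 / p))\<rparr>"

definition composition_operator :: "(complex \<Rightarrow> complex) \<Rightarrow> (complex \<Rightarrow> complex) \<Rightarrow> complex \<Rightarrow> complex" where
  "composition_operator \<phi> f = f \<circ> \<phi>"

end

theory Submission
  imports Defs "HOL-Probability.Distributions"
begin

text \<open>
  If \<open>\<phi>(z) = a z + b\<close> with \<open>|a| < 1\<close>, the sub-mean-value property of \<open>|f|\<^sup>r\<close> on unit discs gives
  \<open>\<parallel>f \<circ> \<phi>\<parallel>\<^sup>r \<le> C \<integral> |f(u)|\<^sup>r e\<^bsup>-r(\<alpha>/2+\<epsilon>)|u|\<^sup>2\<^esup> dA(u)\<close> for some \<open>\<epsilon> > 0\<close>. Since point evaluation,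
  weighted by \<open>e\<^bsup>-\<alpha>|u|\<^sup>2/2\<^esup>\<close>, lies in a multiple of the dual ball independent of \<open>u\<close>, summing over
  finitely many \<open>f\<^sub>j\<close> leaves the convergent integral of \<open>e\<^bsup>-r\<epsilon>|u|\<^sup>2\<^esup>\<close>.

  Conversely, testing a bounded \<open>C\<^sub>\<phi>\<close> on normalized reproducing kernels yields \<open>|\<phi>(z)|\<^sup>2 \<le> |z|\<^sup>2 + M\<close>, so
  \<open>\<phi>\<close> is affine by Liouville. If \<open>|a| \<ge> 1\<close>, take the kernels \<open>k\<^sub>j\<close> at the first \<open>N\<close> integer points of a
  real half-line, chosen so that \<open>\<parallel>C\<^sub>\<phi> k\<^sub>j\<parallel>\<close> is bounded below. For a functional \<open>\<xi>\<close> in the dual ball,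
  \<open>\<Sum>|\<xi>(k\<^sub>j)|\<^sup>r\<close> is at most a constant times \<open>\<Sum>|\<xi>(k\<^sub>j)| = \<xi>(\<Sum> d\<^sub>j k\<^sub>j)\<close> for some \<open>|d\<^sub>j| \<le> 1\<close>, and
  \<open>\<parallel>\<Sum> d\<^sub>j k\<^sub>j\<parallel> = O(N\<^bsup>1/p\<^esup>)\<close> because the Gaussians \<open>|k\<^sub>j(z)| e\<^bsup>-\<alpha>|z|\<^sup>2/2\<^esup>\<close> overlap boundedly. As
  \<open>p > 1\<close>, this is \<open>o(N)\<close>, while summability would force it to be of order \<open>N\<close>.
\<close>

subsection \<open>Sub-mean-value property\<close>

lemma nn_integral_lborel_translate:
  fixes f :: "'a::euclidean_space \<Rightarrow> ennreal"
  assumes [measurable]: "f \<in> borel_measurable borel"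
  shows "(\<integral>\<^sup>+x. f (c + x) \<partial>lborel) = (\<integral>\<^sup>+x. f x \<partial>lborel)"
proof -
  have "(\<integral>\<^sup>+x. f x \<partial>lborel) = (\<integral>\<^sup>+x. f x \<partial>distr lborel borel ((+) c))"
    by (simp add: lborel_distr_plus)
  also have "\<dots> = (\<integral>\<^sup>+x. f (c + x) \<partial>lborel)"
    by (subst nn_integral_distr) auto
  finally show ?thesis ..
qed

lemma emeasure_unit_ball:
  "emeasure lborel (ball (0::complex) 1) \<noteq> 0" "emeasure lborel (ball (0::complex) 1) \<noteq> \<infinity>"
proof -
  show "emeasure lborel (ball (0::complex) 1) \<noteq> \<infinity>"
    using emeasure_bounded_finite[of "ball (0::complex) 1"] by (auto simp: less_top)
  have "measure lborel (ball (0::complex) 1) > 0"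
    using content_ball_pos[of 1 "0::complex"] by simp
  then show "emeasure lborel (ball (0::complex) 1) \<noteq> 0"
    by (auto simp: measure_def)
qed

text \<open>Convolving with the rotation-invariant indicator of the disc reduces this to translation invariance.\<close>

lemma nn_integral_lborel_rotate:
  fixes f :: "complex \<Rightarrow> ennreal"
  assumes [measurable]: "f \<in> borel_measurable borel" and c: "cmod c = 1"
  shows "(\<integral>\<^sup>+x. f (c * x) \<partial>lborel) = (\<integral>\<^sup>+x. f x \<partial>lborel)"
proof -
  define V where "V = emeasure lborel (ball (0::complex) 1)"
  define g :: "complex \<Rightarrow> ennreal" where "g = indicator (ball 0 1)"
  have [measurable]: "g \<in> borel_measurable borel"
    unfolding g_def by (intro borel_measurable_indicator borel_open open_ball)
  have V: "V = (\<integral>\<^sup>+x. g x \<partial>lborel)" unfolding V_def g_def by simp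
  have [measurable]: "(\<lambda>x. c * x) \<in> borel_measurable borel"
    by (intro borel_measurable_continuous_onI continuous_intros)
  have c0: "c \<noteq> 0" using c by auto
  have "(\<integral>\<^sup>+x. f (c * x) \<partial>lborel) * V = (\<integral>\<^sup>+x. f (c * x) * (\<integral>\<^sup>+y. g y \<partial>lborel) \<partial>lborel)"
    unfolding V by (subst nn_integral_multc) auto
  also have "\<dots> = (\<integral>\<^sup>+x. f (c * x) * (\<integral>\<^sup>+y. g (- (c * x) + y) \<partial>lborel) \<partial>lborel)"
    by (subst nn_integral_lborel_translate) auto
  also have "\<dots> = (\<integral>\<^sup>+x. (\<integral>\<^sup>+y. f (c * x) * g (- (c * x) + y) \<partial>lborel) \<partial>lborel)"
    by (subst nn_integral_cmult) auto
  also have "\<dots> = (\<integral>\<^sup>+y. (\<integral>\<^sup>+x. f (c * x) * g (- (c * x) + y) \<partial>lborel) \<partial>lborel)"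
    by (rule lborel_pair.Fubini'[symmetric]) measurable
  also have "\<dots> = (\<integral>\<^sup>+y. (\<integral>\<^sup>+x. f (y + c * x) * g x \<partial>lborel) \<partial>lborel)"
  proof (rule nn_integral_cong)
    fix y :: complex
    \<comment> \<open>Shifting \<open>x\<close> by \<open>y / c\<close> leaves
      \<open>- (c * x)\<close> as the argument of \<open>g\<close>, and the disc does not see the
      unimodular factor \<open>-c\<close>.\<close>
    have "(\<integral>\<^sup>+x. f (c * x) * g (- (c * x) + y) \<partial>lborel)
        = (\<integral>\<^sup>+x. f (c * (y / c + x)) * g (- (c * (y / c + x)) + y) \<partial>lborel)"
      by (rule nn_integral_lborel_translate[symmetric]) measurable
    also have "\<dots> = (\<integral>\<^sup>+x. f (y + c * x) * g x \<partial>lborel)"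
      using c0 by (intro nn_integral_cong)
        (auto simp: g_def indicator_def distrib_left norm_mult c)
    finally show "(\<integral>\<^sup>+x. f (c * x) * g (- (c * x) + y) \<partial>lborel)
        = (\<integral>\<^sup>+x. f (y + c * x) * g x \<partial>lborel)" .
  qed
  also have "\<dots> = (\<integral>\<^sup>+x. (\<integral>\<^sup>+y. f (y + c * x) * g x \<partial>lborel) \<partial>lborel)"
    by (rule lborel_pair.Fubini') measurable
  also have "\<dots> = (\<integral>\<^sup>+x. (\<integral>\<^sup>+y. f y \<partial>lborel) * g x \<partial>lborel)"
  proof (rule nn_integral_cong)
    fix x :: complex
    show "(\<integral>\<^sup>+y. f (y + c * x) * g x \<partial>lborel) = (\<integral>\<^sup>+y. f y \<partial>lborel) * g x"
      using nn_integral_lborel_translate[of f "c * x"]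
      by (subst nn_integral_multc) (auto simp: add.commute)
  qed
  also have "\<dots> = (\<integral>\<^sup>+y. f y \<partial>lborel) * V"
    unfolding V by (subst nn_integral_cmult) auto
  finally have "V * (\<integral>\<^sup>+x. f (c * x) \<partial>lborel) = V * (\<integral>\<^sup>+y. f y \<partial>lborel)"
    by (simp add: mult.commute)
  then show ?thesis
    using emeasure_unit_ball by (simp add: V_def ennreal_mult_cancel_left)
qed

text \<open>Convexity of the power, as the pointwise input to Jensen's inequality. The base point
  \<open>m\<close> need not be the mean itself; a lower bound for the mean will do.\<close>

lemma powr_ge_tangent:
  fixes x m s :: real
  assumes "m > 0" "x \<ge> 0" "s \<ge> 1"
  shows "m powr s + s * m powr (s - 1) * (x - m) \<le> x powr s"
proof (cases "x = 0")
  \<comment> \<open>The tangent argument runs on the open half-line; at \<open>0\<close> the claim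
    reduces to \<open>m powr s \<le> s * m powr s\<close>.\<close>
  case True
  have "m powr (s - 1) * m = m powr s"
    using assms powr_add[of m "s - 1" 1] by simp
  moreover have "m powr s \<le> s * m powr s"
    using assms by (simp add: mult_le_cancel_right1)
  ultimately show ?thesis using True by (simp add: algebra_simps)
next
  case False
  have "((\<lambda>x. x powr s) has_real_derivative s * y powr (s - 1)) (at y)" if "y > 0" for y
    using that by (auto intro!: derivative_eq_intros simp: powr_diff)
  then have "(s * m powr (s - 1)) * (x - m) \<le> x powr s - m powr s"
  proof (intro convex_on_imp_above_tangent[where A="{0<..}"])
    show "convex_on {0<..} (\<lambda>x. x powr s)"
      using assms by (intro powr_convex)
    show "((\<lambda>x. x powr s) has_real_derivative s * m powr (s - 1)) (at m within {0<..})"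
      using assms by (auto intro!: derivative_eq_intros simp: powr_diff)
  qed (use assms False in \<open>auto simp: interior_open connected_Ioi\<close>)
  then show ?thesis by simp
qed

text \<open>Cauchy's integral formula for \<open>\<zeta> \<mapsto> f (w + \<zeta> * u)\<close> on
  the unit circle. Rotating a given vector \<open>u\<close>, instead of fixing a radius, yields a
  form that can later be integrated over \<open>u\<close> in the disc.\<close>

lemma holomorphic_circle_mean:
  assumes f: "f holomorphic_on UNIV"
  shows "((\<lambda>t. f (w + exp (2 * of_real pi * \<i> * of_real t) * u)) has_integral f w) {0..1}"
proof -
  define g where "g = (\<lambda>\<zeta>. f (w + \<zeta> * u))"
  have g: "g holomorphic_on UNIV"
  proof -
    have "(\<lambda>\<zeta>. w + \<zeta> * u) holomorphic_on UNIV" by (intro holomorphic_intros)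
    from holomorphic_on_compose_gen[OF this f] show ?thesis by (simp add: g_def o_def)
  qed
  have "((\<lambda>z. g z / (z - 0)) has_contour_integral (2 * of_real pi * \<i> * g 0)) (circlepath 0 1)"
    using g by (intro Cauchy_integral_circlepath_simple) (auto intro: holomorphic_on_subset)
  then have "((\<lambda>t. g (circlepath 0 1 t) / circlepath 0 1 t *
       vector_derivative (circlepath 0 1) (at t within {0..1})) has_integral
       (2 * of_real pi * \<i> * g 0)) {0..1}"
    by (simp add: has_contour_integral_def)
  \<comment> \<open>The velocity of the circle path is \<open>2 * pi * \<i>\<close> times its
    position, which cancels the denominator.\<close>
  then have "((\<lambda>t. (2 * of_real pi * \<i>) * g (exp (2 * of_real pi * \<i> * of_real t))) has_integral
       (2 * of_real pi * \<i> * g 0)) {0..1}"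
    by (rule has_integral_eq[rotated])
       (auto simp: vector_derivative_circlepath01, auto simp: circlepath)
  from has_integral_mult_right[OF this, of "1 / (2 * of_real pi * \<i>)"]
  show ?thesis by (simp add: g_def)
qed

text \<open>Jensen's inequality: by the mean value property the mean of \<open>h\<close> is at least
  \<open>m\<close>, so integrating the tangent to the power at \<open>m\<close> bounds
  \<open>m powr s\<close> by the mean of \<open>h powr s\<close>.\<close>

lemma norm_powr_le_circle_mean:
  assumes f: "f holomorphic_on UNIV" and s: "s \<ge> 1"
  shows "ennreal (cmod (f w) powr s) \<le>
    (\<integral>\<^sup>+t. indicator {0..1} t * ennreal (cmod (f (w + exp (2 * of_real pi * \<i> * of_real t) * u)) powr s) \<partial>lborel)"
proof (cases "f w = 0")
  case False
  define m where "m = cmod (f w)"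
  define h where "h = (\<lambda>t::real. cmod (f (w + exp (2 * of_real pi * \<i> * of_real t) * u)))"
  have m: "m > 0" using False by (simp add: m_def)
  have cf: "continuous_on UNIV f" using f by (rule holomorphic_on_imp_continuous_on)
  have ch: "continuous_on UNIV h"
    unfolding h_def by (intro continuous_intros continuous_on_compose2[OF cf]) auto
  have chs: "continuous_on UNIV (\<lambda>t. h t powr s)"
    using s ch by (intro continuous_on_powr') (auto simp: h_def)
  have ih: "h integrable_on {0..1}" "(\<lambda>t. h t powr s) integrable_on {0..1}"
    using ch chs by (auto intro!: integrable_continuous_real intro: continuous_on_subset)
  have "m \<le> integral {0..1} h"
  proof -
    let ?F = "\<lambda>t::real. f (w + exp (2 * of_real pi * \<i> * of_real t) * u)"
    note F = holomorphic_circle_mean[OF f, of w u]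
    have "cmod (integral {0..1} ?F) \<le> integral {0..1} h"
      using F ih by (intro integral_norm_bound_integral) (auto simp: h_def)
    then show ?thesis using F by (simp add: m_def integral_unique)
  qed
  then have "m powr s \<le> m powr s + s * m powr (s - 1) * (integral {0..1} h - m)"
    using s by simp
  also have "\<dots> = integral {0..1} (\<lambda>t. m powr s + s * m powr (s - 1) * (h t - m))"
  proof -
    have "((\<lambda>t. m powr s + s * m powr (s - 1) * (h t - m)) has_integral
        m powr s + s * m powr (s - 1) * (integral {0..1} h - m)) {0..1}"
      using ih has_integral_const_real[of "m powr s" 0 1] has_integral_const_real[of m 0 1]
      by (intro has_integral_add has_integral_mult_right has_integral_diff integrable_integral) auto
    then show ?thesis by (simp add: integral_unique)
  qed
  also have "\<dots> \<le> integral {0..1} (\<lambda>t. h t powr s)"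
    using ih m s by (intro integral_le integrable_add integrable_on_mult_right integrable_diff)
      (auto intro!: powr_ge_tangent simp: h_def)
  finally have "m powr s \<le> integral {0..1} (\<lambda>t. h t powr s)" .
  moreover have "(\<integral>\<^sup>+t. indicator {0..1} t * ennreal (h t powr s) \<partial>lborel) = integral {0..1} (\<lambda>t. h t powr s)"
  proof -
    have [measurable]: "(\<lambda>t. h t powr s) \<in> borel_measurable borel"
      using chs by (rule borel_measurable_continuous_onI)
    have "(\<integral>\<^sup>+t. ennreal (indicator {0..1} t * (h t powr s)) \<partial>lborel) = integral {0..1} (\<lambda>t. h t powr s)"
    proof (rule nn_integral_has_integral_lborel)
      show "((\<lambda>t. indicator {0..1} t * (h t powr s)) has_integral integral {0..1} (\<lambda>t. h t powr s)) UNIV"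
        by (rule has_integral_eq[OF _ has_integral_restrict_UNIV[THEN iffD2, OF integrable_integral[OF ih(2)]]]) auto
    qed auto
    then show ?thesis by (simp add: ennreal_mult'[symmetric] ennreal_indicator[symmetric] del: ennreal_indicator)
  qed
  ultimately show ?thesis unfolding m_def h_def by (simp add: ennreal_leI)
qed simp

text \<open>Integrate the circle means over \<open>u\<close> in the disc and exchange the integrals.
  For each angle \<open>t\<close> the rotation by \<open>e t\<close> preserves both the disc and
  Lebesgue measure, so the inner integral does not depend on \<open>t\<close>; no polar coordinates
  are involved.\<close>

lemma norm_powr_le_disc_mean:
  assumes f: "f holomorphic_on UNIV" and s: "s \<ge> 1"
  shows "ennreal (cmod (f w) powr s) * emeasure lborel (ball (0::complex) 1) \<le>
    (\<integral>\<^sup>+u. indicator (ball 0 1) u * ennreal (cmod (f (w + u)) powr s) \<partial>lborel)"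
proof -
  define e where "e = (\<lambda>t::real. exp (2 * of_real pi * \<i> * of_real t))"
  define F where "F = (\<lambda>u. ennreal (cmod (f (w + u)) powr s))"
  define g :: "complex \<Rightarrow> ennreal" where "g = indicator (ball 0 1)"
  have cf: "continuous_on UNIV f" using f by (rule holomorphic_on_imp_continuous_on)
  have e[simp]: "cmod (e t) = 1" for t by (simp add: e_def)
  have [measurable]: "e \<in> borel_measurable borel" unfolding e_def
    by (intro borel_measurable_continuous_onI continuous_intros)
  have "continuous_on UNIV (\<lambda>u. cmod (f (w + u)) powr s)"
    using s by (intro continuous_on_powr' continuous_intros continuous_on_compose2[OF cf]) auto
  then have [measurable]: "F \<in> borel_measurable borel"
    unfolding F_def by (intro measurable_compose[OF _ measurable_ennreal] borel_measurable_continuous_onI)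
  have [measurable]: "g \<in> borel_measurable borel"
    unfolding g_def by (intro borel_measurable_indicator borel_open open_ball)
  have grot: "g (e t * u) = g u" for t u by (simp add: g_def indicator_def norm_mult)
  have "ennreal (cmod (f w) powr s) * emeasure lborel (ball (0::complex) 1)
      = (\<integral>\<^sup>+u. g u * ennreal (cmod (f w) powr s) \<partial>lborel)"
    by (subst nn_integral_multc) (auto simp: g_def mult.commute intro!: borel_measurable_indicator)
  also have "\<dots> \<le> (\<integral>\<^sup>+u. g u * (\<integral>\<^sup>+t. indicator {0..1} t * F (e t * u) \<partial>lborel) \<partial>lborel)"
    unfolding F_def e_def by (intro nn_integral_mono mult_left_mono norm_powr_le_circle_mean f s) auto
  also have "\<dots> = (\<integral>\<^sup>+u. (\<integral>\<^sup>+t. indicator {0..1} t * (g u * F (e t * u)) \<partial>lborel) \<partial>lborel)"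
    by (subst nn_integral_cmult[symmetric]) (auto simp: ac_simps)
  also have "\<dots> = (\<integral>\<^sup>+t. (\<integral>\<^sup>+u. indicator {0..1} t * (g u * F (e t * u)) \<partial>lborel) \<partial>lborel)"
    by (rule lborel_pair.Fubini'[symmetric]) measurable
  also have "\<dots> = (\<integral>\<^sup>+t. indicator {0..1} t * (\<integral>\<^sup>+u. g (e t * u) * F (e t * u) \<partial>lborel) \<partial>lborel)"
    by (subst nn_integral_cmult) (auto simp: grot)
  also have "\<dots> = (\<integral>\<^sup>+t. indicator {0..1::real} t * (\<integral>\<^sup>+u. g u * F u \<partial>lborel) \<partial>lborel)"
    by (subst nn_integral_lborel_rotate[where f="\<lambda>u. g u * F u"]) auto
  also have "\<dots> = (\<integral>\<^sup>+u. g u * F u \<partial>lborel)"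
    by (subst nn_integral_multc) auto
  finally show ?thesis by (simp add: F_def g_def)
qed

subsection \<open>Gaussians\<close>

lemma integrable_gaussian_real:
  assumes "c > 0"
  shows "integrable lborel (\<lambda>x::real. exp (- c * x\<^sup>2))"
proof -
  define \<sigma> where "\<sigma> = sqrt (1 / (2 * c))"
  have s: "\<sigma> > 0" "\<sigma>\<^sup>2 = 1 / (2 * c)" using assms by (auto simp: \<sigma>_def)
  have "exp (- c * x\<^sup>2) = sqrt (2 * pi * \<sigma>\<^sup>2) * normal_density 0 \<sigma> x" for x
    using assms s by (simp add: normal_density_def field_simps)
  then show ?thesis using s by auto
qed

lemma integrable_gaussian:
  fixes w :: complex
  assumes "c > 0"
  shows "integrable lborel (\<lambda>z::complex. exp (- c * (cmod (z - w))\<^sup>2))"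
proof (rule integrableI_bounded)
  let ?g = "\<lambda>z::complex. ennreal (exp (- c * (cmod z)\<^sup>2))"
  show "(\<lambda>z::complex. exp (- c * (cmod (z - w))\<^sup>2)) \<in> borel_measurable lborel" by measurable
  have "(\<integral>\<^sup>+z. ?g (- w + z) \<partial>lborel) = (\<integral>\<^sup>+z. ?g z \<partial>lborel)"
    by (rule nn_integral_lborel_translate) measurable
  also have "\<dots> = (\<integral>\<^sup>+z. (\<Prod>b\<in>(Basis::complex set). ennreal (exp (- c * (inner z b)\<^sup>2))) \<partial>lborel)"
    by (intro nn_integral_cong)
      (simp add: cmod_power2 Basis_complex_def distrib_left ennreal_mult[symmetric] exp_add[symmetric])
  also have "\<dots> = (\<Prod>b\<in>(Basis::complex set). \<integral>\<^sup>+x. ennreal (exp (- c * x\<^sup>2)) \<partial>lborel)"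
    by (subst nn_integral_lborel_prod[symmetric]) (auto simp: prod_ennreal)
  also have "\<dots> < \<infinity>"
    using integrable_gaussian_real[OF assms]
    by (auto simp: Basis_complex_def integrable_iff_bounded intro!: ennreal_mult_less_top[THEN iffD2])
  finally show "(\<integral>\<^sup>+z. ennreal (norm (exp (- c * (cmod (z - w))\<^sup>2))) \<partial>lborel) < \<infinity>"
    by simp
qed

subsection \<open>Fock spaces and point evaluation\<close>

abbreviation unit_disc_area :: real where
  "unit_disc_area \<equiv> measure lborel (ball (0::complex) 1)"

lemma unit_disc_area_pos: "unit_disc_area > 0"
  using content_ball_pos[of 1 "0::complex"] by simp

text \<open>The disc mean in the form used below: the majorant \<open>G\<close> has to dominate only
  on the unit disc about \<open>w\<close>, and being nonnegative it may then be integrated over the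
  whole plane.\<close>

lemma norm_powr_le_integral:
  assumes f: "f holomorphic_on UNIV" and s: "s \<ge> 1"
    and G: "integrable lborel G" "\<And>u. 0 \<le> G u"
    and le: "\<And>u. cmod (u - w) < 1 \<Longrightarrow> cmod (f u) powr s \<le> G u"
  shows "cmod (f w) powr s * unit_disc_area \<le> (LINT u|lborel. G u)"
proof -
  have [measurable]: "G \<in> borel_measurable borel" using G by simp
  have V: "emeasure lborel (ball (0::complex) 1) = ennreal unit_disc_area"
    using emeasure_unit_ball by (intro emeasure_eq_ennreal_measure) (auto simp: top_unique)
  have "ennreal (cmod (f w) powr s * unit_disc_area)
      \<le> (\<integral>\<^sup>+u. indicator (ball 0 1) u * ennreal (cmod (f (w + u)) powr s) \<partial>lborel)"
    using norm_powr_le_disc_mean[OF f s, of w] by (simp add: V ennreal_mult)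
  also have "\<dots> \<le> (\<integral>\<^sup>+u. ennreal (G (w + u)) \<partial>lborel)"
    by (intro nn_integral_mono) (auto simp: indicator_def intro!: ennreal_leI le)
  also have "\<dots> = (\<integral>\<^sup>+u. ennreal (G u) \<partial>lborel)"
    by (rule nn_integral_lborel_translate) measurable
  also have "\<dots> = ennreal (LINT u|lborel. G u)"
    using G by (intro nn_integral_eq_integral) auto
  finally show ?thesis using G by (simp add: ennreal_le_iff integral_nonneg_AE)
qed

lemma powr_mult_exp:
  assumes "(x::real) \<ge> 0"
  shows "(x * exp y) powr p = x powr p * exp (p * y)"
  using assms by (simp add: powr_mult exp_powr_real mult.commute)

lemma powr_inverse_powr:
  assumes "(x::real) \<ge> 0" "p \<noteq> 0"
  shows "(x powr (1 / p)) powr p = x" "(x powr p) powr (1 / p) = x"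
  using assms by (simp_all add: powr_powr)

text \<open>Moving the weight inside the power lets pointwise bounds on
  \<open>|f z| * exp (- \<alpha> / 2 * |z|^2)\<close> pass directly to norms.\<close>

lemma fock_space_points:
  "f \<in> points (fock_space p \<alpha>) \<longleftrightarrow> f holomorphic_on UNIV \<and>
     integrable lborel (\<lambda>z. (cmod (f z) * exp (- (\<alpha> / 2) * (cmod z)\<^sup>2)) powr p)"
  by (simp add: fock_space_def powr_mult_exp algebra_simps)

lemma fock_space_norm:
  "vnorm (fock_space p \<alpha>) f =
     (LINT z|lborel. (cmod (f z) * exp (- (\<alpha> / 2) * (cmod z)\<^sup>2)) powr p) powr (1 / p)"
  by (simp add: fock_space_def powr_mult_exp algebra_simps)

lemma fock_space_norm_nonneg: "0 \<le> vnorm (fock_space p \<alpha>) f"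
  by (simp add: fock_space_norm)

text \<open>Monotonicity of the integral, giving membership and a norm bound from one pointwise
  estimate; it serves for compositions, single kernels and combinations of kernels alike.\<close>

lemma fock_space_norm_le:
  assumes f: "f holomorphic_on UNIV" and p: "p > 0" and A: "A \<ge> 0"
    and G: "\<And>z. 0 \<le> G z" "integrable lborel (\<lambda>z. G z powr p)"
    and le: "\<And>z. cmod (f z) * exp (- (\<alpha> / 2) * (cmod z)\<^sup>2) \<le> A * G z"
  shows "f \<in> points (fock_space p \<alpha>)"
    and "vnorm (fock_space p \<alpha>) f \<le> A * (LINT z|lborel. G z powr p) powr (1 / p)"
proof -
  let ?F = "\<lambda>z. (cmod (f z) * exp (- (\<alpha> / 2) * (cmod z)\<^sup>2)) powr p"
  have le': "?F z \<le> A powr p * G z powr p" for z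
    using powr_mono2[OF _ _ le[of z], of p] p A G by (simp add: powr_mult)
  have cf: "continuous_on UNIV f" using f by (rule holomorphic_on_imp_continuous_on)
  have "f \<in> borel_measurable borel" using cf by (rule borel_measurable_continuous_onI)
  then have F: "?F \<in> borel_measurable lborel" by measurable
  have int: "integrable lborel ?F"
    by (rule Bochner_Integration.integrable_bound[of lborel "\<lambda>z. A powr p * G z powr p", OF _ F]) (use G le' in \<open>auto intro!: AE_I2\<close>)
  then show "f \<in> points (fock_space p \<alpha>)" using f by (simp add: fock_space_points)
  have "(LINT z|lborel. ?F z) \<le> (LINT z|lborel. A powr p * G z powr p)"
    using int G le' by (intro integral_mono) auto
  also have "\<dots> = A powr p * (LINT z|lborel. G z powr p)" by simp
  finally have "(LINT z|lborel. ?F z) powr (1 / p) \<le> (A powr p * (LINT z|lborel. G z powr p)) powr (1 / p)"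
    using p by (intro powr_mono2) (auto intro!: integral_nonneg_AE)
  also have "\<dots> = A * (LINT z|lborel. G z powr p) powr (1 / p)"
    using p A by (simp add: powr_mult integral_nonneg_AE powr_inverse_powr)
  finally show "vnorm (fock_space p \<alpha>) f \<le> A * (LINT z|lborel. G z powr p) powr (1 / p)"
    by (simp add: fock_space_norm)
qed

lemma gaussian_shift_identity:
  "(cmod (u - w))\<^sup>2 = (cmod u)\<^sup>2 - 2 * Re (u * cnj w) + (cmod w)\<^sup>2"
  unfolding cmod_power2 by (simp add: power2_eq_square algebra_simps)

text \<open>The constant that the unit disc produces: \<open>exp (p * \<alpha> / 2)\<close> bounds
  the twisted Gaussian factor there. It is not sharp, but it is independent of the evaluation
  point.\<close>

definition eval_const :: "real \<Rightarrow> real \<Rightarrow> real" where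
  "eval_const p \<alpha> = (exp (p * \<alpha> / 2) / unit_disc_area) powr (1 / p)"

lemma eval_const_pos: "eval_const p \<alpha> > 0"
  using unit_disc_area_pos by (simp add: eval_const_def)

lemma fock_space_eval_le:
  assumes f: "f \<in> points (fock_space p \<alpha>)" and p: "p \<ge> 1" and \<alpha>: "\<alpha> > 0"
  shows "cmod (f w) * exp (- (\<alpha> / 2) * (cmod w)\<^sup>2) \<le> eval_const p \<alpha> * vnorm (fock_space p \<alpha>) f"
proof -
  let ?F = "\<lambda>z. (cmod (f z) * exp (- (\<alpha> / 2) * (cmod z)\<^sup>2)) powr p"
  \<comment> \<open>The twist turns the weight at \<open>u\<close> into a Gaussian centred at \<open>w\<close>, which is bounded below on the disc.\<close>
  let ?g = "\<lambda>u. f u * exp (of_real \<alpha> * (of_real ((cmod w)\<^sup>2 / 2) - u * cnj w))"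
  have hol: "?g holomorphic_on UNIV"
    using f by (auto simp: fock_space_points intro!: holomorphic_intros)
  have g: "cmod (?g u) powr p = ?F u * exp (p * \<alpha> / 2 * (cmod (u - w))\<^sup>2)" for u
  proof -
    have "cmod (?g u) = cmod (f u) * exp (\<alpha> * ((cmod w)\<^sup>2 / 2 - Re (u * cnj w)))"
      by (simp add: norm_mult)
    also have "\<alpha> * ((cmod w)\<^sup>2 / 2 - Re (u * cnj w)) = - (\<alpha> / 2) * (cmod u)\<^sup>2 + \<alpha> / 2 * (cmod (u - w))\<^sup>2"
      unfolding gaussian_shift_identity by (simp add: field_simps)
    finally have "cmod (?g u) = (cmod (f u) * exp (- (\<alpha> / 2) * (cmod u)\<^sup>2)) * exp (\<alpha> / 2 * (cmod (u - w))\<^sup>2)"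
      by (simp only: exp_add mult.assoc)
    then show ?thesis
      using powr_mult_exp[of "cmod (f u) * exp (- (\<alpha> / 2) * (cmod u)\<^sup>2)" "\<alpha> / 2 * (cmod (u - w))\<^sup>2" p]
      by (simp add: mult.assoc)
  qed
  have int: "integrable lborel ?F" using f by (simp add: fock_space_points)
  have "cmod (?g w) powr p * unit_disc_area \<le> (LINT u|lborel. exp (p * \<alpha> / 2) * ?F u)"
  proof (rule norm_powr_le_integral[OF hol p])
    fix u assume u: "cmod (u - w) < 1"
    then have "(cmod (u - w))\<^sup>2 \<le> 1" by (simp add: power_le_one)
    then have "exp (p * \<alpha> / 2 * (cmod (u - w))\<^sup>2) \<le> exp (p * \<alpha> / 2)"
      using p \<alpha> by (simp add: mult_le_cancel_left1)
    then show "cmod (?g u) powr p \<le> exp (p * \<alpha> / 2) * ?F u"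
      unfolding g by (simp add: mult.commute mult_right_mono)
  qed (use int in auto)
  \<comment> \<open>At \<open>u = w\<close> the Gaussian factor in \<open>g\<close> equals 1, so the
    twist is invisible on the left.\<close>
  then have "?F w \<le> exp (p * \<alpha> / 2) / unit_disc_area * (LINT u|lborel. ?F u)"
    using unit_disc_area_pos unfolding g by (simp add: field_simps)
  then have "?F w powr (1 / p) \<le> (exp (p * \<alpha> / 2) / unit_disc_area * (LINT u|lborel. ?F u)) powr (1 / p)"
    using p by (intro powr_mono2) auto
  also have "\<dots> = eval_const p \<alpha> * vnorm (fock_space p \<alpha>) f"
    unfolding eval_const_def fock_space_norm
    by (rule powr_mult)
  finally show ?thesis using p by (simp add: powr_inverse_powr del: powr_mult)
qed

text \<open>These functionals convert the supremum over the dual ball into a bound at every point of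
  the plane.\<close>

lemma evaluation_in_dual_ball:
  assumes "p \<ge> 1" "\<alpha> > 0"
  shows "(\<lambda>f. f w * of_real (exp (- (\<alpha> / 2) * (cmod w)\<^sup>2) / eval_const p \<alpha>)) \<in> dual_ball (fock_space p \<alpha>)"
proof -
  have "cmod (f w * of_real (exp (- (\<alpha> / 2) * (cmod w)\<^sup>2) / eval_const p \<alpha>)) \<le> vnorm (fock_space p \<alpha>) f"
    if "f \<in> points (fock_space p \<alpha>)" for f
    using fock_space_eval_le[OF that assms, of w] eval_const_pos[of p \<alpha>]
    by (simp add: norm_mult norm_divide field_simps)
  then show ?thesis
    unfolding dual_ball_def linear_operator_def scalar_field_def
    by (auto simp: fock_space_def algebra_simps add_divide_distrib)
qed

subsection \<open>Affine contractions\<close>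

text \<open>To be applied with \<open>t = |z|\<close> and \<open>x = |u|\<close> for
  \<open>u\<close> in the unit disc about \<open>a * z + b\<close>, so that \<open>s = |a|\<close>
  and \<open>d = |b| + 1\<close>. Strict contraction leaves room to worsen the Gaussian exponents on
  both sides by \<open>\<epsilon>\<close>.\<close>

lemma quadratic_absorption:
  fixes \<alpha> s d :: real
  assumes "0 \<le> s" "s < 1" "0 \<le> d" "\<alpha> > 0"
  obtains \<epsilon> M where "\<epsilon> > 0"
    "\<And>t x. 0 \<le> t \<Longrightarrow> 0 \<le> x \<Longrightarrow> x \<le> s * t + d \<Longrightarrow> (\<alpha> / 2 + \<epsilon>) * x\<^sup>2 \<le> (\<alpha> / 2 - \<epsilon>) * t\<^sup>2 + M"
proof -
  \<comment> \<open>In terms of \<open>k\<close> the two coefficients are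
    \<open>\<alpha> / 2 * (1 + k)\<close> and \<open>\<alpha> / 2 * (1 - k)\<close>. With a further
    factor \<open>1 + k\<close> from Young's inequality, the claim reduces to
    \<open>(1 + k)^2 * s^2 \<le> 1 - k\<close>.\<close>
  define \<epsilon> where "\<epsilon> = \<alpha> / 2 * (1 - s) / 4"
  define k where "k = (1 - s) / 4"
  have k: "0 < k" "k \<le> 1/4" "s = 1 - 4 * k" "\<epsilon> = \<alpha> / 2 * k" using assms by (auto simp: k_def \<epsilon>_def field_simps)
  show ?thesis
  proof (rule that[of \<epsilon> "(\<alpha> / 2 + \<epsilon>) * ((1 + 1 / k) * d\<^sup>2)"])
    show "\<epsilon> > 0" using mult_pos_pos[OF assms(4) k(1)] k(4) by simp
    fix t x :: real assume t: "0 \<le> t" "0 \<le> x" "x \<le> s * t + d"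
    have "x\<^sup>2 \<le> (s * t + d)\<^sup>2" using t by (intro power_mono) auto
    \<comment> \<open>Young's inequality with weight \<open>k\<close> for the cross term
      \<open>2 * s * t * d\<close>.\<close>
    also have "\<dots> \<le> (1 + k) * (s * t)\<^sup>2 + (1 + 1 / k) * d\<^sup>2"
    proof -
      have "0 \<le> (k * (s * t) - d)\<^sup>2 / k" using k by simp
      also have "\<dots> = k * (s * t)\<^sup>2 - 2 * (s * t) * d + d\<^sup>2 / k"
        using k by (simp add: power2_eq_square field_simps)
      finally show ?thesis by (simp add: power2_eq_square field_simps)
    qed
    finally have "(\<alpha> / 2 + \<epsilon>) * x\<^sup>2 \<le> (\<alpha> / 2 + \<epsilon>) * ((1 + k) * (s * t)\<^sup>2 + (1 + 1 / k) * d\<^sup>2)"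
      using assms mult_pos_pos[OF assms(4) k(1)] k(4) by (intro mult_left_mono) auto
    moreover have "(1 + k) * ((1 + k) * s\<^sup>2) \<le> 1 - k"
    proof -
      have "k * s \<le> k * 1" using k(1) assms by (intro mult_left_mono) auto
      then have a: "(1 + k) * s \<le> 1 - 3 * k" "0 \<le> (1 + k) * s"
        using k(1,3) assms by (simp_all add: distrib_right)
      have "(1 + k) * ((1 + k) * s\<^sup>2) = ((1 + k) * s)\<^sup>2" by (simp add: power2_eq_square algebra_simps)
      also have "\<dots> \<le> (1 - 3 * k)\<^sup>2" using a by (intro power_mono) auto
      also have "\<dots> \<le> 1 - k"
        using mult_nonneg_nonneg[of k "5 - 9 * k"] k by (simp add: power2_eq_square algebra_simps)
      finally show ?thesis .
    qed
    then have "\<alpha> / 2 * ((1 + k) * ((1 + k) * s\<^sup>2)) * t\<^sup>2 \<le> \<alpha> / 2 * (1 - k) * t\<^sup>2"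
      using assms by (intro mult_right_mono mult_left_mono) auto
    then have "(\<alpha> / 2 + \<epsilon>) * ((1 + k) * (s * t)\<^sup>2) \<le> (\<alpha> / 2 - \<epsilon>) * t\<^sup>2"
      unfolding k(4) by (simp add: power_mult_distrib algebra_simps)
    ultimately show "(\<alpha> / 2 + \<epsilon>) * x\<^sup>2 \<le> (\<alpha> / 2 - \<epsilon>) * t\<^sup>2 + (\<alpha> / 2 + \<epsilon>) * ((1 + 1 / k) * d\<^sup>2)"
      by (simp only: distrib_left)
  qed
qed

text \<open>A Pietsch domination: up to a constant, \<open>J f\<close> is the integral of
  \<open>|\<xi> f| powr r\<close> over normalized evaluations \<open>\<xi>\<close> in the dual ball,
  against a finite Gaussian measure. Once the r-th power of the norm of
  \<open>f \<circ> \<phi>\<close> is dominated by \<open>J f\<close>, summability follows by adding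
  up.\<close>

lemma affine_composition_summing:
  assumes \<alpha>: "\<alpha> > 0" and p: "p \<ge> 1" and r: "r \<ge> 1" and a: "cmod a < 1" and \<phi>: "\<And>z. \<phi> z = a * z + b"
  shows "r_summing r (fock_space p \<alpha>) (fock_space p \<alpha>) (composition_operator \<phi>)"
proof -
  let ?X = "fock_space p \<alpha>"
  define K where "K = eval_const p \<alpha>"
  obtain \<epsilon> M where \<epsilon>: "\<epsilon> > 0" and M: "\<And>t x. 0 \<le> t \<Longrightarrow> 0 \<le> x \<Longrightarrow> x \<le> cmod a * t + (cmod b + 1) \<Longrightarrow>
      (\<alpha> / 2 + \<epsilon>) * x\<^sup>2 \<le> (\<alpha> / 2 - \<epsilon>) * t\<^sup>2 + M"
    using quadratic_absorption[of "cmod a" "cmod b + 1" \<alpha>] a \<alpha> by auto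
  define I where "I = (LINT z|lborel. exp (- \<epsilon> * (cmod z)\<^sup>2) powr p)"
  define I2 where "I2 = (LINT u::complex|lborel. exp (- (r * \<epsilon>) * (cmod u)\<^sup>2))"
  define D where "D = exp (r * M) / unit_disc_area"
  define J where "J = (\<lambda>f. LINT u|lborel. (cmod (f u) * exp (- (\<alpha> / 2) * (cmod u)\<^sup>2)) powr r * exp (- (r * \<epsilon>) * (cmod u)\<^sup>2))"
  have D: "D > 0" using unit_disc_area_pos by (simp add: D_def)
  have K: "K > 0" by (simp add: K_def eval_const_pos)
  have hol: "f holomorphic_on UNIV" if "f \<in> points ?X" for f
    using that by (simp add: fock_space_points)
  have g1: "integrable lborel (\<lambda>z::complex. exp (- \<epsilon> * (cmod z)\<^sup>2) powr p)"
    using integrable_gaussian[of "\<epsilon> * p" 0] \<epsilon> p by (simp add: exp_powr_real mult_ac)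
  have g2: "integrable lborel (\<lambda>u::complex. exp (- (r * \<epsilon>) * (cmod u)\<^sup>2))"
    using integrable_gaussian[of "r * \<epsilon>" 0] \<epsilon> r by simp
  have intJ: "integrable lborel (\<lambda>u. (cmod (f u) * exp (- (\<alpha> / 2) * (cmod u)\<^sup>2)) powr r * exp (- (r * \<epsilon>) * (cmod u)\<^sup>2))"
    if f: "f \<in> points ?X" for f
  proof (rule Bochner_Integration.integrable_bound)
    show "integrable lborel (\<lambda>u::complex. (K * vnorm ?X f) powr r * exp (- (r * \<epsilon>) * (cmod u)\<^sup>2))"
      using g2 by simp
    have "continuous_on UNIV f" using hol[OF f] by (rule holomorphic_on_imp_continuous_on)
    then have [measurable]: "f \<in> borel_measurable borel" by (rule borel_measurable_continuous_onI)
    show "(\<lambda>u. (cmod (f u) * exp (- (\<alpha> / 2) * (cmod u)\<^sup>2)) powr r * exp (- (r * \<epsilon>) * (cmod u)\<^sup>2)) \<in> borel_measurable lborel"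
      by measurable
    show "AE u in lborel. norm ((cmod (f u) * exp (- (\<alpha> / 2) * (cmod u)\<^sup>2)) powr r * exp (- (r * \<epsilon>) * (cmod u)\<^sup>2))
        \<le> norm ((K * vnorm ?X f) powr r * exp (- (r * \<epsilon>) * (cmod u)\<^sup>2))"
      using fock_space_eval_le[OF f p \<alpha>] r
      by (intro AE_I2) (auto simp: K_def intro!: mult_right_mono powr_mono2)
  qed
  have J0: "0 \<le> J f" for f by (simp add: J_def)
  have pt: "cmod (f (\<phi> z)) powr r * exp (- (r * (\<alpha> / 2 - \<epsilon>)) * (cmod z)\<^sup>2) \<le> D * J f"
    if f: "f \<in> points ?X" for f z
  proof -
    \<comment> \<open>\<open>E\<close> is chosen so that
      \<open>E * exp (- r * (\<alpha> / 2 + \<epsilon>) * |u|^2) \<ge> 1\<close> on the unit disc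
      about \<open>\<phi> z\<close>. The surplus \<open>\<epsilon>\<close> in \<open>u\<close> makes
      \<open>J\<close> finite.\<close>
    define E where "E = exp (r * ((\<alpha> / 2 - \<epsilon>) * (cmod z)\<^sup>2 + M))"
    have "cmod (f (\<phi> z)) powr r * unit_disc_area \<le>
      (LINT u|lborel. E * ((cmod (f u) * exp (- (\<alpha> / 2) * (cmod u)\<^sup>2)) powr r * exp (- (r * \<epsilon>) * (cmod u)\<^sup>2)))"
    proof (rule norm_powr_le_integral[OF hol[OF f] r])
      fix u assume "cmod (u - \<phi> z) < 1"
      moreover have "cmod u \<le> cmod (u - \<phi> z) + cmod (\<phi> z)"
        by (metis diff_add_cancel norm_triangle_ineq)
      moreover have "cmod (\<phi> z) \<le> cmod a * cmod z + cmod b"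
        unfolding \<phi> using norm_triangle_ineq[of "a * z" b] by (simp add: norm_mult)
      ultimately have "(\<alpha> / 2 + \<epsilon>) * (cmod u)\<^sup>2 \<le> (\<alpha> / 2 - \<epsilon>) * (cmod z)\<^sup>2 + M"
        by (intro M) auto
      then have "r * ((\<alpha> / 2 + \<epsilon>) * (cmod u)\<^sup>2) \<le> r * ((\<alpha> / 2 - \<epsilon>) * (cmod z)\<^sup>2 + M)"
        using r by (intro mult_left_mono) auto
      then have "1 \<le> E * exp (- (r * ((\<alpha> / 2 + \<epsilon>) * (cmod u)\<^sup>2)))"
        by (simp add: E_def exp_add[symmetric])
      then have "cmod (f u) powr r * 1 \<le> cmod (f u) powr r * (E * exp (- (r * ((\<alpha> / 2 + \<epsilon>) * (cmod u)\<^sup>2))))"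
        by (intro mult_left_mono) auto
      also have "exp (- (r * ((\<alpha> / 2 + \<epsilon>) * (cmod u)\<^sup>2))) = exp (r * (- (\<alpha> / 2) * (cmod u)\<^sup>2)) * exp (- (r * \<epsilon>) * (cmod u)\<^sup>2)"
        by (simp add: exp_add[symmetric] algebra_simps)
      finally show "cmod (f u) powr r \<le> E * ((cmod (f u) * exp (- (\<alpha> / 2) * (cmod u)\<^sup>2)) powr r * exp (- (r * \<epsilon>) * (cmod u)\<^sup>2))"
        by (simp add: powr_mult_exp mult_ac)
    qed (use intJ[OF f] in \<open>auto simp: E_def\<close>)
    then have "cmod (f (\<phi> z)) powr r * unit_disc_area \<le> E * J f" by (simp add: J_def)
    then have "cmod (f (\<phi> z)) powr r * unit_disc_area * exp (- (r * (\<alpha> / 2 - \<epsilon>)) * (cmod z)\<^sup>2)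
        \<le> E * J f * exp (- (r * (\<alpha> / 2 - \<epsilon>)) * (cmod z)\<^sup>2)"
      by (intro mult_right_mono) auto
    also have "\<dots> = (E * exp (- (r * (\<alpha> / 2 - \<epsilon>)) * (cmod z)\<^sup>2)) * J f" by (simp only: mult_ac)
    also have "E * exp (- (r * (\<alpha> / 2 - \<epsilon>)) * (cmod z)\<^sup>2) = exp (r * M)"
      by (simp add: E_def exp_add[symmetric] algebra_simps)
    finally have "cmod (f (\<phi> z)) powr r * unit_disc_area * exp (- (r * (\<alpha> / 2 - \<epsilon>)) * (cmod z)\<^sup>2) \<le> exp (r * M) * J f" .
    then show ?thesis using unit_disc_area_pos by (simp add: D_def field_simps)
  qed
  have comp: "f \<circ> \<phi> \<in> points ?X"
    "vnorm ?X (f \<circ> \<phi>) \<le> (D * J f) powr (1 / r) * I powr (1 / p)" if f: "f \<in> points ?X" for f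
  proof -
    have h: "(f \<circ> \<phi>) holomorphic_on UNIV"
    proof -
      have "\<phi> = (\<lambda>z. a * z + b)" using \<phi> by auto
      then have "\<phi> holomorphic_on UNIV" by (auto intro!: holomorphic_intros)
      then show ?thesis by (rule holomorphic_on_compose_gen[OF _ hol[OF f]]) auto
    qed
    \<comment> \<open>The surplus \<open>\<epsilon>\<close> in \<open>z\<close> is what remains as
      an integrable Gaussian majorant for the norm.\<close>
    have le: "cmod ((f \<circ> \<phi>) z) * exp (- (\<alpha> / 2) * (cmod z)\<^sup>2) \<le> (D * J f) powr (1 / r) * exp (- \<epsilon> * (cmod z)\<^sup>2)" for z
    proof -
      have "(cmod (f (\<phi> z)) * exp (- (\<alpha> / 2 - \<epsilon>) * (cmod z)\<^sup>2)) powr r \<le> D * J f"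
        using pt[OF f, of z] by (subst powr_mult_exp) (simp_all add: algebra_simps)
      then have "((cmod (f (\<phi> z)) * exp (- (\<alpha> / 2 - \<epsilon>) * (cmod z)\<^sup>2)) powr r) powr (1 / r) \<le> (D * J f) powr (1 / r)"
        using r by (intro powr_mono2) auto
      then have "cmod (f (\<phi> z)) * exp (- (\<alpha> / 2 - \<epsilon>) * (cmod z)\<^sup>2) \<le> (D * J f) powr (1 / r)"
        using r by (simp add: powr_inverse_powr)
      then have "(cmod (f (\<phi> z)) * exp (- (\<alpha> / 2 - \<epsilon>) * (cmod z)\<^sup>2)) * exp (- \<epsilon> * (cmod z)\<^sup>2)
          \<le> (D * J f) powr (1 / r) * exp (- \<epsilon> * (cmod z)\<^sup>2)"
        by (intro mult_right_mono) auto
      also have "(cmod (f (\<phi> z)) * exp (- (\<alpha> / 2 - \<epsilon>) * (cmod z)\<^sup>2)) * exp (- \<epsilon> * (cmod z)\<^sup>2)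
          = cmod (f (\<phi> z)) * exp (- (\<alpha> / 2) * (cmod z)\<^sup>2)"
        by (simp add: mult.assoc exp_add[symmetric] algebra_simps)
      finally show ?thesis by simp
    qed
    show "f \<circ> \<phi> \<in> points ?X"
      by (rule fock_space_norm_le(1)[OF h _ _ _ g1 le]) (use p in auto)
    show "vnorm ?X (f \<circ> \<phi>) \<le> (D * J f) powr (1 / r) * I powr (1 / p)"
      unfolding I_def by (rule fock_space_norm_le(2)[OF h _ _ _ g1 le]) (use p in auto)
  qed
  have lin: "linear_operator ?X ?X (composition_operator \<phi>)"
    using comp(1) by (simp add: linear_operator_def composition_operator_def fock_space_def o_def)
  \<comment> \<open>\<open>D\<close> and \<open>I\<close> come from the norm bound in
    \<open>comp\<close>; \<open>K\<close> and \<open>I2\<close> come from integrating the pointwise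
    bound \<open>weak\<close>.\<close>
  define C where "C = (D * (I powr (1 / p)) powr r * (K powr r * I2)) powr (1 / r)"
  have "(\<Sum>j<n. vnorm ?X (composition_operator \<phi> (x j)) powr r) powr (1 / r)
      \<le> C * (SUP \<xi>\<in>dual_ball ?X. (\<Sum>j<n. cmod (\<xi> (x j)) powr r) powr (1 / r))" (is "_ \<le> C * ?S")
    if x: "\<forall>j<n. x j \<in> points ?X" for n :: nat and x
  proof -
    have bdd: "bdd_above ((\<lambda>\<xi>. (\<Sum>j<n. cmod (\<xi> (x j)) powr r) powr (1 / r)) ` dual_ball ?X)"
      using x r by (intro bdd_above_weak_sums) auto
    \<comment> \<open>Nonnegativity, obtained from the zero functional, is needed to cancel the
      powers \<open>r\<close> and \<open>1 / r\<close> on the supremum.\<close>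
    have S0: "0 \<le> ?S"
      using cSUP_upper[OF zero_in_dual_ball[OF fock_space_norm_nonneg] bdd] r
      by simp
    have weak: "(\<Sum>j<n. (cmod (x j u) * exp (- (\<alpha> / 2) * (cmod u)\<^sup>2)) powr r) \<le> K powr r * ?S powr r" for u
    proof -
      let ?\<xi> = "\<lambda>f. f u * complex_of_real (exp (- (\<alpha> / 2) * (cmod u)\<^sup>2) / eval_const p \<alpha>)"
      have e: "cmod (?\<xi> f) powr r = (cmod (f u) * exp (- (\<alpha> / 2) * (cmod u)\<^sup>2)) powr r / K powr r" for f
        using K by (simp add: norm_mult norm_divide K_def powr_divide)
      have "(\<Sum>j<n. cmod (?\<xi> (x j)) powr r) powr (1 / r) \<le> ?S"
        by (rule cSUP_upper[OF evaluation_in_dual_ball[OF p \<alpha>] bdd])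
      then have "((\<Sum>j<n. cmod (?\<xi> (x j)) powr r) powr (1 / r)) powr r \<le> ?S powr r"
        using r by (intro powr_mono2) auto
      then have "(\<Sum>j<n. cmod (?\<xi> (x j)) powr r) \<le> ?S powr r"
        using r by (subst (asm) powr_inverse_powr) (auto intro!: sum_nonneg)
      then show ?thesis
        using K unfolding e sum_divide_distrib[symmetric] by (simp add: field_simps)
    qed
    have "(\<Sum>j<n. J (x j)) = (LINT u|lborel. (\<Sum>j<n. (cmod (x j u) * exp (- (\<alpha> / 2) * (cmod u)\<^sup>2)) powr r) * exp (- (r * \<epsilon>) * (cmod u)\<^sup>2))"
      unfolding J_def sum_distrib_right using x by (intro Bochner_Integration.integral_sum[symmetric] intJ) auto
    also have "\<dots> \<le> (LINT u::complex|lborel. (K powr r * ?S powr r) * exp (- (r * \<epsilon>) * (cmod u)\<^sup>2))"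
    proof (rule integral_mono)
      show "integrable lborel (\<lambda>u. (\<Sum>j<n. (cmod (x j u) * exp (- (\<alpha> / 2) * (cmod u)\<^sup>2)) powr r) * exp (- (r * \<epsilon>) * (cmod u)\<^sup>2))"
        unfolding sum_distrib_right using x by (intro Bochner_Integration.integrable_sum intJ) auto
    qed (use g2 weak in \<open>auto intro!: mult_right_mono\<close>)
    also have "\<dots> = K powr r * ?S powr r * I2" by (simp add: I2_def)
    finally have sumJ: "(\<Sum>j<n. J (x j)) \<le> K powr r * ?S powr r * I2" .
    have "(\<Sum>j<n. vnorm ?X (composition_operator \<phi> (x j)) powr r) \<le> (\<Sum>j<n. D * (I powr (1 / p)) powr r * J (x j))"
    proof (intro sum_mono)
      fix j assume "j \<in> {..<n}"
      then have "vnorm ?X (x j \<circ> \<phi>) powr r \<le> ((D * J (x j)) powr (1 / r) * I powr (1 / p)) powr r"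
        using x r by (intro powr_mono2 comp fock_space_norm_nonneg) auto
      also have "\<dots> = D * (I powr (1 / p)) powr r * J (x j)"
        using r D J0 by (simp add: powr_mult powr_inverse_powr)
      finally show "vnorm ?X (composition_operator \<phi> (x j)) powr r \<le> D * (I powr (1 / p)) powr r * J (x j)"
        by (simp add: composition_operator_def)
    qed
    also have "\<dots> = D * (I powr (1 / p)) powr r * (\<Sum>j<n. J (x j))" by (simp add: sum_distrib_left)
    also have "\<dots> \<le> D * (I powr (1 / p)) powr r * (K powr r * ?S powr r * I2)"
      using D by (intro mult_left_mono sumJ) simp
    also have "\<dots> = (D * (I powr (1 / p)) powr r * (K powr r * I2)) * ?S powr r"
      by (simp only: mult_ac)
    finally have "(\<Sum>j<n. vnorm ?X (composition_operator \<phi> (x j)) powr r)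
        \<le> (D * (I powr (1 / p)) powr r * (K powr r * I2)) * ?S powr r" .
    then have "(\<Sum>j<n. vnorm ?X (composition_operator \<phi> (x j)) powr r) powr (1 / r)
        \<le> ((D * (I powr (1 / p)) powr r * (K powr r * I2)) * ?S powr r) powr (1 / r)"
      using r by (intro powr_mono2 sum_nonneg) auto
    also have "\<dots> = C * ?S"
      using r S0 D by (simp add: C_def powr_mult powr_inverse_powr I2_def)
    finally show ?thesis .
  qed
  moreover have "C \<ge> 0" by (simp add: C_def)
  ultimately show ?thesis unfolding r_summing_def using lin by blast
qed

subsection \<open>Reproducing kernels\<close>

text \<open>Up to a constant factor, the reproducing kernel of the Hilbert case
  \<open>p = 2\<close>, normalized there. The factor \<open>exp (- \<alpha> * |w|^2 / 2)\<close>
  makes the weighted modulus a translate to \<open>w\<close> of one fixed Gaussian, so it serves for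
  every \<open>p\<close>.\<close>

definition fock_kernel :: "real \<Rightarrow> complex \<Rightarrow> complex \<Rightarrow> complex" where
  "fock_kernel \<alpha> w z = exp (of_real \<alpha> * (z * cnj w - of_real ((cmod w)\<^sup>2 / 2)))"

lemma fock_kernel_holomorphic: "fock_kernel \<alpha> w holomorphic_on UNIV"
  unfolding fock_kernel_def by (intro holomorphic_intros)

lemma norm_fock_kernel: "cmod (fock_kernel \<alpha> w z) = exp (\<alpha> / 2 * (cmod z)\<^sup>2 - \<alpha> / 2 * (cmod (z - w))\<^sup>2)"
proof -
  have "cmod (fock_kernel \<alpha> w z) = exp (\<alpha> * (Re (z * cnj w) - (cmod w)\<^sup>2 / 2))"
    by (simp add: fock_kernel_def)
  also have "\<alpha> * (Re (z * cnj w) - (cmod w)\<^sup>2 / 2) = \<alpha> / 2 * (cmod z)\<^sup>2 - \<alpha> / 2 * (cmod (z - w))\<^sup>2"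
    unfolding gaussian_shift_identity by (simp add: field_simps)
  finally show ?thesis .
qed

lemma norm_fock_kernel_weighted:
  "cmod (fock_kernel \<alpha> w z) * exp (- (\<alpha> / 2) * (cmod z)\<^sup>2) = exp (- (\<alpha> / 2) * (cmod (z - w))\<^sup>2)"
  by (simp add: norm_fock_kernel exp_add[symmetric])

lemma lborel_integral_translate:
  fixes f :: "complex \<Rightarrow> real"
  assumes [measurable]: "f \<in> borel_measurable borel"
  shows "(LINT x|lborel. f (x - c)) = (LINT x|lborel. f x)"
proof -
  have "(LINT x|lborel. f x) = (LINT x|distr lborel borel ((+) (- c)). f x)"
    by (simp add: lborel_distr_plus)
  also have "\<dots> = (LINT x|lborel. f (- c + x))"
    by (subst integral_distr) auto
  finally show ?thesis by simp
qed

definition gaussian_integral :: "real \<Rightarrow> real" where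
  "gaussian_integral c = (LINT z::complex|lborel. exp (- c * (cmod z)\<^sup>2))"

lemma gaussian_integral_translate:
  "(LINT z|lborel. exp (- c * (cmod (z - w))\<^sup>2)) = gaussian_integral c"
  unfolding gaussian_integral_def
  by (rule lborel_integral_translate[where f="\<lambda>z. exp (- c * (cmod z)\<^sup>2)"]) measurable

lemma fock_kernel_in_fock_space:
  assumes "\<alpha> > 0" "p > 0"
  shows "fock_kernel \<alpha> w \<in> points (fock_space p \<alpha>)"
    and "vnorm (fock_space p \<alpha>) (fock_kernel \<alpha> w) \<le> gaussian_integral (p * \<alpha> / 2) powr (1 / p)"
proof -
  have e: "exp (- (\<alpha> / 2) * (cmod (z - w))\<^sup>2) powr p = exp (- (p * \<alpha> / 2) * (cmod (z - w))\<^sup>2)" for z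
    by (simp add: exp_powr_real mult_ac)
  have int: "integrable lborel (\<lambda>z. exp (- (\<alpha> / 2) * (cmod (z - w))\<^sup>2) powr p)"
    unfolding e using assms by (intro integrable_gaussian) auto
  have le: "cmod (fock_kernel \<alpha> w z) * exp (- (\<alpha> / 2) * (cmod z)\<^sup>2) \<le> 1 * exp (- (\<alpha> / 2) * (cmod (z - w))\<^sup>2)" for z
    by (simp only: norm_fock_kernel_weighted)
  show "fock_kernel \<alpha> w \<in> points (fock_space p \<alpha>)"
    by (rule fock_space_norm_le(1)[OF fock_kernel_holomorphic _ _ _ int le]) (use assms in auto)
  have "vnorm (fock_space p \<alpha>) (fock_kernel \<alpha> w)
      \<le> 1 * (LINT z|lborel. exp (- (\<alpha> / 2) * (cmod (z - w))\<^sup>2) powr p) powr (1 / p)"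
    by (rule fock_space_norm_le(2)[OF fock_kernel_holomorphic _ _ _ int le]) (use assms in auto)
  then show "vnorm (fock_space p \<alpha>) (fock_kernel \<alpha> w) \<le> gaussian_integral (p * \<alpha> / 2) powr (1 / p)"
    unfolding e gaussian_integral_translate by simp
qed

subsection \<open>Linear combinations of kernels\<close>

text \<open>On either side of \<open>m\<close> the distances to the indices are distinct, so each
  half is at most a full geometric series.\<close>

lemma sum_geometric_dist_le:
  fixes m :: int and q :: real
  assumes "0 < q" "q < 1"
  shows "(\<Sum>j<N. q ^ nat \<bar>m - int j\<bar>) \<le> 2 / (1 - q)"
proof -
  have part: "(\<Sum>j\<in>A. q ^ nat \<bar>m - int j\<bar>) \<le> 1 / (1 - q)"
    if "finite A" "inj_on (\<lambda>j. nat \<bar>m - int j\<bar>) A" for A :: "nat set"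
  proof -
    have "(\<Sum>j\<in>A. q ^ nat \<bar>m - int j\<bar>) = (\<Sum>k\<in>(\<lambda>j. nat \<bar>m - int j\<bar>) ` A. q ^ k)"
      using that by (simp add: sum.reindex)
    also have "\<dots> \<le> (\<Sum>k. q ^ k)"
      using assms that by (intro sum_le_suminf) (auto intro: summable_geometric)
    also have "\<dots> = 1 / (1 - q)" using assms by (intro suminf_geometric) auto
    finally show ?thesis .
  qed
  have "(\<Sum>j<N. q ^ nat \<bar>m - int j\<bar>) =
      (\<Sum>j\<in>{j\<in>{..<N}. int j \<le> m}. q ^ nat \<bar>m - int j\<bar>) + (\<Sum>j\<in>{j\<in>{..<N}. \<not> int j \<le> m}. q ^ nat \<bar>m - int j\<bar>)"
    by (subst sum.union_disjoint[symmetric]) (auto intro!: sum.cong)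
  also have "\<dots> \<le> 1 / (1 - q) + 1 / (1 - q)"
    by (intro add_mono part) (auto simp: inj_on_def)
  finally show ?thesis by simp
qed

text \<open>Completing the square; exponential decay then allows comparison with a geometric
  series.\<close>

lemma gaussian_le_exp:
  assumes "\<beta> > (0::real)"
  shows "exp (- \<beta> * t\<^sup>2) \<le> exp (1 / (4 * \<beta>)) * exp (- t)"
proof -
  have "0 \<le> \<beta> * (t - 1 / (2 * \<beta>))\<^sup>2" using assms by simp
  also have "\<dots> = \<beta> * t\<^sup>2 - t + 1 / (4 * \<beta>)"
    using assms by (simp add: power2_eq_square field_simps)
  finally have "- \<beta> * t\<^sup>2 \<le> 1 / (4 * \<beta>) + - t" by simp
  then show ?thesis by (simp only: exp_add[symmetric] exp_le_cancel_iff)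
qed

lemma sum_gaussian_bounded:
  assumes "\<beta> > (0::real)"
  obtains M where "M > 0" "\<And>x N. (\<Sum>j<N. exp (- \<beta> * (x - real j)\<^sup>2)) \<le> M"
proof
  define q :: real where "q = exp (-1)"
  have q: "0 < q" "q < 1" by (auto simp: q_def)
  define D where "D = exp (1 / (4 * \<beta>)) * exp 1"
  have D: "D > 0" by (simp add: D_def)
  show "D * (2 / (1 - q)) > 0" using D q by simp
  fix x :: real and N :: nat
  have "exp (- \<beta> * (x - real j)\<^sup>2) \<le> D * q ^ nat \<bar>\<lfloor>x\<rfloor> - int j\<bar>" for j :: nat
  proof -
    \<comment> \<open>Replacing \<open>x\<close> by its floor changes the distance by at most 1,
      which accounts for the factor \<open>exp 1\<close> in \<open>D\<close>.\<close>
    have "real (nat \<bar>\<lfloor>x\<rfloor> - int j\<bar>) \<le> \<bar>x - real j\<bar> + 1" by linarith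
    then have "exp (- \<bar>x - real j\<bar>) \<le> exp (1 + - real (nat \<bar>\<lfloor>x\<rfloor> - int j\<bar>))" by simp
    also have "\<dots> = exp 1 * q ^ nat \<bar>\<lfloor>x\<rfloor> - int j\<bar>"
      unfolding q_def exp_add by (simp add: exp_of_nat_mult[symmetric])
    finally have "exp (1 / (4 * \<beta>)) * exp (- \<bar>x - real j\<bar>) \<le> D * q ^ nat \<bar>\<lfloor>x\<rfloor> - int j\<bar>"
      by (simp add: D_def mult.assoc)
    then show ?thesis using gaussian_le_exp[OF assms, of "\<bar>x - real j\<bar>"] by simp
  qed
  then have "(\<Sum>j<N. exp (- \<beta> * (x - real j)\<^sup>2)) \<le> (\<Sum>j<N. D * q ^ nat \<bar>\<lfloor>x\<rfloor> - int j\<bar>)"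
    by (intro sum_mono)
  also have "\<dots> = D * (\<Sum>j<N. q ^ nat \<bar>\<lfloor>x\<rfloor> - int j\<bar>)" by (simp add: sum_distrib_left)
  also have "\<dots> \<le> D * (2 / (1 - q))"
    using D q by (intro mult_left_mono sum_geometric_dist_le) auto
  finally show "(\<Sum>j<N. exp (- \<beta> * (x - real j)\<^sup>2)) \<le> D * (2 / (1 - q))" .
qed

text \<open>The weighted combination is at most the Gaussian sum \<open>H\<close>, which is bounded
  by \<open>M\<close> and has integral proportional to \<open>N\<close>. Hence
  \<open>H powr p \<le> M powr (p - 1) * H\<close>, and the norm grows only like
  \<open>N powr (1 / p)\<close> instead of \<open>N\<close>.\<close>

lemma fock_kernel_combination_norm:
  fixes \<sigma> :: real
  assumes \<alpha>: "\<alpha> > 0" and p: "p \<ge> 1" and \<sigma>: "\<bar>\<sigma>\<bar> = 1"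
  obtains B where "B > 0"
    "\<And>N c. \<forall>j. cmod (c j) \<le> 1 \<Longrightarrow>
      (\<lambda>z. \<Sum>j<N. c j * fock_kernel \<alpha> (of_real (\<sigma> * real j)) z) \<in> points (fock_space p \<alpha>) \<and>
      vnorm (fock_space p \<alpha>) (\<lambda>z. \<Sum>j<N. c j * fock_kernel \<alpha> (of_real (\<sigma> * real j)) z) \<le> B * real N powr (1 / p)"
proof -
  obtain M where M: "M > 0" "\<And>x N. (\<Sum>j<N. exp (- (\<alpha> / 2) * (x - real j)\<^sup>2)) \<le> M"
    using sum_gaussian_bounded[of "\<alpha> / 2"] \<alpha> by auto
  define B where "B = (M powr (p - 1) * gaussian_integral (\<alpha> / 2)) powr (1 / p)"
  let ?f = "\<lambda>c N z. \<Sum>j<N. c j * fock_kernel \<alpha> (of_real (\<sigma> * real j)) z"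
  \<comment> \<open>Adding 1 to \<open>B\<close> secures a positive constant from its nonnegativity
    alone.\<close>
  have "?f c N \<in> points (fock_space p \<alpha>) \<and> vnorm (fock_space p \<alpha>) (?f c N) \<le> (B + 1) * real N powr (1 / p)"
    if c: "\<forall>j. cmod (c j) \<le> 1" for c N
  proof -
    define H where "H = (\<lambda>z. \<Sum>j<N. exp (- (\<alpha> / 2) * (cmod (z - of_real (\<sigma> * real j)))\<^sup>2))"
    \<comment> \<open>This majorant of \<open>H\<close> has a p-th power that is linear in
      \<open>H\<close>, so its integral is explicit.\<close>
    define G where "G = (\<lambda>z. (M powr (p - 1) * H z) powr (1 / p))"
    have H0: "0 \<le> H z" for z by (simp add: H_def sum_nonneg)
    have HM: "H z \<le> M" for z
    proof -
      \<comment> \<open>Projecting to the real axis and reflecting by \<open>\<sigma>\<close>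
        reduces \<open>H\<close> to the one-dimensional sum over \<open>real j\<close>.\<close>
      have "(\<sigma> * Re z - real j)\<^sup>2 \<le> (cmod (z - of_real (\<sigma> * real j)))\<^sup>2" for j
      proof -
        have "\<sigma> * \<sigma> = 1" using \<sigma> by (metis abs_mult_self_eq mult_1)
        then have "\<sigma> * Re z - real j = \<sigma> * Re (z - of_real (\<sigma> * real j))"
          by (simp add: right_diff_distrib flip: mult.assoc)
        then have "\<bar>\<sigma> * Re z - real j\<bar> \<le> cmod (z - of_real (\<sigma> * real j))"
          using \<sigma> abs_Re_le_cmod[of "z - of_real (\<sigma> * real j)"] by (simp only: abs_mult mult_1)
        then show ?thesis by (simp add: abs_le_square_iff[symmetric])
      qed
      then have "H z \<le> (\<Sum>j<N. exp (- (\<alpha> / 2) * (\<sigma> * Re z - real j)\<^sup>2))"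
        unfolding H_def using \<alpha> by (intro sum_mono) (simp add: mult_left_mono)
      also have "\<dots> \<le> M" by (rule M)
      finally show ?thesis .
    qed
    have Gp: "G z powr p = M powr (p - 1) * H z" for z
      unfolding G_def using p H0 M by (intro powr_inverse_powr) auto
    have HG: "H z \<le> G z" for z
    proof (cases "H z = 0")
      case False
      have "H z powr p = H z powr (p - 1) * H z"
        using False H0[of z] powr_add[of "H z" "p - 1" 1] by simp
      also have "\<dots> \<le> M powr (p - 1) * H z"
        using p H0 HM by (intro mult_right_mono powr_mono2) auto
      finally have "(H z powr p) powr (1 / p) \<le> G z"
        unfolding G_def using p by (intro powr_mono2) auto
      then show ?thesis using p H0 by (simp add: powr_inverse_powr)
    qed (simp add: G_def)
    have intH: "integrable lborel H" unfolding H_def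
      using \<alpha> by (intro Bochner_Integration.integrable_sum integrable_gaussian) auto
    then have int: "integrable lborel (\<lambda>z. G z powr p)" unfolding Gp by simp
    have LH: "(LINT z|lborel. H z) = real N * gaussian_integral (\<alpha> / 2)"
    proof -
      have "(LINT z|lborel. H z) = (\<Sum>j<N. LINT z|lborel. exp (- (\<alpha> / 2) * (cmod (z - of_real (\<sigma> * real j)))\<^sup>2))"
        unfolding H_def using \<alpha> by (intro Bochner_Integration.integral_sum integrable_gaussian) auto
      then show ?thesis unfolding gaussian_integral_translate by simp
    qed
    have hol: "?f c N holomorphic_on UNIV"
      by (intro holomorphic_intros fock_kernel_holomorphic)
    have le: "cmod (?f c N z) * exp (- (\<alpha> / 2) * (cmod z)\<^sup>2) \<le> 1 * G z" for z
    proof -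
      have "cmod (?f c N z) \<le> (\<Sum>j<N. cmod (fock_kernel \<alpha> (of_real (\<sigma> * real j)) z))"
      proof (rule order_trans[OF norm_sum sum_mono])
        fix j show "cmod (c j * fock_kernel \<alpha> (of_real (\<sigma> * real j)) z) \<le> cmod (fock_kernel \<alpha> (of_real (\<sigma> * real j)) z)"
          using mult_right_mono[OF c[rule_format, of j], of "cmod (fock_kernel \<alpha> (of_real (\<sigma> * real j)) z)"] by (simp add: norm_mult)
      qed
      then have "cmod (?f c N z) * exp (- (\<alpha> / 2) * (cmod z)\<^sup>2)
          \<le> (\<Sum>j<N. cmod (fock_kernel \<alpha> (of_real (\<sigma> * real j)) z)) * exp (- (\<alpha> / 2) * (cmod z)\<^sup>2)"
        by (intro mult_right_mono) auto
      also have "\<dots> = H z" unfolding H_def sum_distrib_right by (simp only: norm_fock_kernel_weighted)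
      finally show ?thesis using HG[of z] by simp
    qed
    have "?f c N \<in> points (fock_space p \<alpha>)"
      by (rule fock_space_norm_le(1)[OF hol _ _ _ int le]) (use p in \<open>auto simp: G_def\<close>)
    moreover have "vnorm (fock_space p \<alpha>) (?f c N) \<le> 1 * (LINT z|lborel. G z powr p) powr (1 / p)"
      by (rule fock_space_norm_le(2)[OF hol _ _ _ int le]) (use p in \<open>auto simp: G_def\<close>)
    moreover have "(LINT z|lborel. G z powr p) powr (1 / p) = B * real N powr (1 / p)"
      unfolding Gp by (simp add: LH B_def powr_mult mult_ac)
    moreover have "\<dots> \<le> (B + 1) * real N powr (1 / p)"
      by (intro mult_right_mono) auto
    ultimately show ?thesis by simp
  qed
  moreover have "B + 1 > 0" by (simp add: B_def add_nonneg_pos)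
  ultimately show ?thesis using that by blast
qed

text \<open>Functionals in \<open>dual_ball\<close> are linear only on the points of the space, so
  the induction needs every partial sum and every scaled term to be a point.\<close>

lemma dual_ball_sum:
  fixes n :: nat
  assumes \<xi>: "\<xi> \<in> dual_ball (fock_space p \<alpha>)"
    and f: "\<And>j. f j \<in> points (fock_space p \<alpha>)"
    and partial: "\<And>m. (\<lambda>z. \<Sum>j<m. c j * f j z) \<in> points (fock_space p \<alpha>)"
    and scaled: "\<And>j. (\<lambda>z. c j * f j z) \<in> points (fock_space p \<alpha>)"
  shows "\<xi> (\<lambda>z. \<Sum>j<n. c j * f j z) = (\<Sum>j<n. c j * \<xi> (f j))"
proof -
  have add: "\<xi> (\<lambda>z. g z + h z) = \<xi> g + \<xi> h" if "g \<in> points (fock_space p \<alpha>)" "h \<in> points (fock_space p \<alpha>)" for g h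
    using \<xi> that by (simp add: dual_ball_def linear_operator_def scalar_field_def fock_space_def)
  have scale: "\<xi> (\<lambda>z. d * g z) = d * \<xi> g" if "g \<in> points (fock_space p \<alpha>)" for d g
    using \<xi> that by (simp add: dual_ball_def linear_operator_def scalar_field_def fock_space_def)
  show ?thesis
  proof (induction n)
    case 0
    show ?case using scale[OF f[of 0], of 0] by simp
  next
    case (Suc n)
    then show ?case
      using add[OF partial[of n] scaled[of n]] scale[OF f[of n], of "c n"] by simp
  qed
qed

subsection \<open>Summing composition operators\<close>

lemma bounded_composition_affine:
  assumes hol: "\<phi> holomorphic_on UNIV" and M: "\<And>z. (cmod (\<phi> z))\<^sup>2 \<le> (cmod z)\<^sup>2 + M"
  obtains a b where "\<And>z. \<phi> z = a * z + b"
proof -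
  \<comment> \<open>For \<open>|z| \<ge> 1\<close> one has
    \<open>|z|^2 + M \<le> (1 + |M|) * |z|^2\<close>, which gives the linear growth needed for
    Liouville's theorem in degree 1.\<close>
  define B where "B = sqrt (1 + \<bar>M\<bar>)"
  have growth: "cmod (\<phi> z) \<le> B * cmod z ^ 1" if z: "1 \<le> cmod z" for z
  proof -
    have "1 \<le> (cmod z)\<^sup>2" using z by simp
    then have "\<bar>M\<bar> * 1 \<le> \<bar>M\<bar> * (cmod z)\<^sup>2" by (intro mult_left_mono) auto
    then have "(cmod (\<phi> z))\<^sup>2 \<le> (B * cmod z)\<^sup>2"
      using M[of z] by (simp add: B_def power_mult_distrib algebra_simps)
    then have "cmod (\<phi> z) \<le> B * cmod z"
      by (rule power2_le_imp_le) (simp add: B_def)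
    then show ?thesis by simp
  qed
  have "\<phi> z = deriv \<phi> 0 * z + \<phi> 0" for z
    using Liouville_polynomial[OF hol growth, where \<xi>=z] by (simp add: add.commute)
  then show ?thesis by (rule that)
qed

lemma summing_composition_affine:
  assumes \<alpha>: "\<alpha> > 0" and p: "p > 1" and r: "r \<ge> 1" and hol: "\<phi> holomorphic_on UNIV"
    and sum: "r_summing r (fock_space p \<alpha>) (fock_space p \<alpha>) (composition_operator \<phi>)"
  shows "\<exists>a b. cmod a < 1 \<and> (\<forall>z. \<phi> z = a * z + b)"
proof -
  let ?X = "fock_space p \<alpha>" and ?T = "composition_operator \<phi>"
  define K where "K = eval_const p \<alpha>"
  have K: "K > 0" by (simp add: K_def eval_const_pos)
  define c where "c = gaussian_integral (p * \<alpha> / 2) powr (1 / p)"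
  have kin: "fock_kernel \<alpha> w \<in> points ?X" and kle: "vnorm ?X (fock_kernel \<alpha> w) \<le> c" for w
    using fock_kernel_in_fock_space[of \<alpha> p w] \<alpha> p by (auto simp: c_def)
  have c0: "c \<ge> 0" by (simp add: c_def)
  obtain C where C: "C \<ge> 0" and summing: "\<And>(n::nat) x. (\<forall>j<n. x j \<in> points ?X) \<Longrightarrow>
        (\<Sum>j<n. vnorm ?X (?T (x j)) powr r) powr (1 / r)
          \<le> C * (SUP \<xi>\<in>dual_ball ?X. (\<Sum>j<n. cmod (\<xi> (x j)) powr r) powr (1 / r))"
    using sum unfolding r_summing_def by blast
  have Tin: "?T f \<in> points ?X" if "f \<in> points ?X" for f
    using sum that by (simp add: r_summing_def linear_operator_def)
  have ne: "dual_ball ?X \<noteq> {}" using zero_in_dual_ball[of ?X] fock_space_norm_nonneg by blast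
  \<comment> \<open>Any uniform bound \<open>S\<close> over the dual ball replaces the supremum, and
    the outer powers \<open>1 / r\<close> are removed.\<close>
  have summing_le: "(\<Sum>j<n. vnorm ?X (?T (x j)) powr r) \<le> C powr r * S"
    if x: "\<And>j. x j \<in> points ?X" and S: "S \<ge> 0" "\<And>\<xi>. \<xi> \<in> dual_ball ?X \<Longrightarrow> (\<Sum>j<n. cmod (\<xi> (x j)) powr r) \<le> S"
    for n :: nat and x and S
  proof -
    have "(\<Sum>j<n. vnorm ?X (?T (x j)) powr r) powr (1 / r)
        \<le> C * (SUP \<xi>\<in>dual_ball ?X. (\<Sum>j<n. cmod (\<xi> (x j)) powr r) powr (1 / r))"
      using x by (intro summing) auto
    also have "\<dots> \<le> C * S powr (1 / r)"
      using C r S by (intro mult_left_mono cSUP_least ne powr_mono2 sum_nonneg) auto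
    finally have "((\<Sum>j<n. vnorm ?X (?T (x j)) powr r) powr (1 / r)) powr r \<le> (C * S powr (1 / r)) powr r"
      using r by (intro powr_mono2) auto
    then show ?thesis
      using r C S by (simp add: powr_mult powr_inverse_powr sum_nonneg)
  qed
  have \<xi>le: "cmod (\<xi> (fock_kernel \<alpha> w)) \<le> c" if "\<xi> \<in> dual_ball ?X" for \<xi> w
    using that kin[of w] kle[of w] by (force simp: dual_ball_def)
  \<comment> \<open>Point evaluation of the image at \<open>z\<close>, with the kernel centred at
    \<open>\<phi> z\<close>, where its modulus is
    \<open>exp (\<alpha> / 2 * |\<phi> z|^2)\<close>.\<close>
  have lower: "exp (\<alpha> / 2 * ((cmod (\<phi> z))\<^sup>2 - (cmod z)\<^sup>2)) \<le> K * vnorm ?X (?T (fock_kernel \<alpha> (\<phi> z)))" for z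
    using fock_space_eval_le[OF Tin[OF kin[of "\<phi> z"]], of z] p \<alpha>
    by (simp add: composition_operator_def norm_fock_kernel K_def exp_add[symmetric] algebra_simps)
  have upper: "vnorm ?X (?T (fock_kernel \<alpha> w)) powr r \<le> (C * c) powr r" for w
  proof -
    \<comment> \<open>Sequences of length one: a summing operator is bounded.\<close>
    have "(\<Sum>j<1::nat. vnorm ?X (?T (fock_kernel \<alpha> w)) powr r) \<le> C powr r * c powr r"
    proof (rule summing_le)
      show "(\<Sum>j<1::nat. cmod (\<xi> (fock_kernel \<alpha> w)) powr r) \<le> c powr r" if "\<xi> \<in> dual_ball ?X" for \<xi>
        using r \<xi>le[OF that] by (simp add: powr_mono2)
    qed (auto intro: kin)
    then show ?thesis using C c0 by (simp add: powr_mult)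
  qed
  have upper': "vnorm ?X (?T (fock_kernel \<alpha> w)) \<le> C * c" for w
    using upper[of w] r C c0 fock_space_norm_nonneg[of p \<alpha> "?T (fock_kernel \<alpha> w)"]
    by (smt (verit) powr_less_mono2 mult_nonneg_nonneg)
  define M where "M = 2 / \<alpha> * ln (K * (C * c))"
  have M: "(cmod (\<phi> z))\<^sup>2 \<le> (cmod z)\<^sup>2 + M" for z
  proof -
    have "exp (\<alpha> / 2 * ((cmod (\<phi> z))\<^sup>2 - (cmod z)\<^sup>2)) \<le> K * (C * c)"
      using K by (intro order_trans[OF lower mult_left_mono] upper') auto
    \<comment> \<open>The logarithm may be taken because the exponential on the left forces
      \<open>K * (C * c)\<close> to be positive.\<close>
    then have "\<alpha> / 2 * ((cmod (\<phi> z))\<^sup>2 - (cmod z)\<^sup>2) \<le> ln (K * (C * c))"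
      by (subst ln_ge_iff) (rule less_le_trans[OF exp_gt_zero])
    then show ?thesis using \<alpha> by (simp add: M_def field_simps)
  qed
  obtain a b where ab: "\<And>z. \<phi> z = a * z + b"
    using bounded_composition_affine[OF hol M] by blast
  have "cmod a < 1"
  proof (rule ccontr)
    assume "\<not> cmod a < 1"
    then have a: "cmod a \<ge> 1" "a \<noteq> 0" by auto
    \<comment> \<open>The half-line points in the direction that makes the cross term in
      \<open>|w j - b|^2\<close> nonpositive.\<close>
    define \<sigma> :: real where "\<sigma> = (if Re b \<ge> 0 then 1 else -1)"
    have \<sigma>: "\<bar>\<sigma>\<bar> = 1" "\<sigma> * Re b \<ge> 0" by (auto simp: \<sigma>_def)
    define w where "w = (\<lambda>j::nat. complex_of_real (\<sigma> * real j))"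
    obtain B where B: "B > 0" and BB: "\<And>N d. \<forall>j. cmod (d j) \<le> 1 \<Longrightarrow>
        (\<lambda>z. \<Sum>j<N. d j * fock_kernel \<alpha> (w j) z) \<in> points ?X \<and>
        vnorm ?X (\<lambda>z. \<Sum>j<N. d j * fock_kernel \<alpha> (w j) z) \<le> B * real N powr (1 / p)"
      using fock_kernel_combination_norm[OF \<alpha> less_imp_le[OF p] \<sigma>(1)] unfolding w_def by blast
    note BX = BB[THEN conjunct1] and BN = BB[THEN conjunct2]
    define c0 where "c0 = exp (- (\<alpha> / 2 * (cmod b)\<^sup>2)) / K"
    have c0: "c0 > 0" using K by (simp add: c0_def)
    have low: "c0 \<le> vnorm ?X (?T (fock_kernel \<alpha> (w j)))" for j
    proof -
      \<comment> \<open>The preimage of \<open>w j\<close> under \<open>\<phi>\<close>; since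
        \<open>|a| \<ge> 1\<close>, it satisfies \<open>|z| \<le> |w j - b|\<close>.\<close>
      define z where "z = (w j - b) / a"
      have z: "\<phi> z = w j" using a by (simp add: ab z_def)
      have "cmod z \<le> cmod (w j - b)"
        using a by (simp add: z_def norm_divide divide_le_eq mult_le_cancel_left1)
      then have "(cmod z)\<^sup>2 \<le> (cmod (w j - b))\<^sup>2" by (intro power_mono) auto
      also have "\<dots> = (cmod (w j))\<^sup>2 - 2 * (real j * (\<sigma> * Re b)) + (cmod b)\<^sup>2"
        unfolding gaussian_shift_identity by (simp add: w_def)
      also have "\<dots> \<le> (cmod (w j))\<^sup>2 + (cmod b)\<^sup>2" using \<sigma> by simp
      finally have "\<alpha> / 2 * (- (cmod b)\<^sup>2) \<le> \<alpha> / 2 * ((cmod (\<phi> z))\<^sup>2 - (cmod z)\<^sup>2)"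
        unfolding z using \<alpha> by (intro mult_left_mono) auto
      then have "exp (- (\<alpha> / 2 * (cmod b)\<^sup>2)) \<le> exp (\<alpha> / 2 * ((cmod (\<phi> z))\<^sup>2 - (cmod z)\<^sup>2))" by simp
      also note lower[of z]
      finally show ?thesis using K unfolding z by (simp add: c0_def field_simps)
    qed
    have weak: "(\<Sum>j<N. cmod (\<xi> (fock_kernel \<alpha> (w j))) powr r) \<le> c powr (r - 1) * (B * real N powr (1 / p))"
      if \<xi>: "\<xi> \<in> dual_ball ?X" for \<xi> N
    proof -
      \<comment> \<open>Phases that turn each \<open>\<xi> (k j)\<close> into its modulus; where the
        value vanishes, \<open>sgn\<close> gives coefficient 0.\<close>
      define d where "d = (\<lambda>j. cnj (sgn (\<xi> (fock_kernel \<alpha> (w j)))))"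
      have d: "\<forall>j. cmod (d j) \<le> 1" by (simp add: d_def norm_sgn)
      have dx: "d j * \<xi> (fock_kernel \<alpha> (w j)) = of_real (cmod (\<xi> (fock_kernel \<alpha> (w j))))" for j
      proof (cases "\<xi> (fock_kernel \<alpha> (w j)) = 0")
        case False
        then show ?thesis
          by (simp add: d_def sgn_eq complex_norm_square[symmetric] mult.commute[of "cnj _"] power2_eq_square)
      qed simp
      have "(\<lambda>z. d j * fock_kernel \<alpha> (w j) z) \<in> points ?X" for j
      proof -
        \<comment> \<open>A single scaled kernel is a combination whose only possibly nonzero
          coefficient is the last one.\<close>
        have "(\<lambda>z. \<Sum>i<Suc j. (if i = j then d j else 0) * fock_kernel \<alpha> (w i) z) \<in> points ?X"
          using d by (intro BX) auto
        then show ?thesis by (simp add: if_distrib[of "\<lambda>x. x * _"] cong: if_cong)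
      qed
      then have "\<xi> (\<lambda>z. \<Sum>j<N. d j * fock_kernel \<alpha> (w j) z) = (\<Sum>j<N. d j * \<xi> (fock_kernel \<alpha> (w j)))"
        using d by (intro dual_ball_sum[OF \<xi>] kin BX)
      then have "(\<Sum>j<N. cmod (\<xi> (fock_kernel \<alpha> (w j)))) = cmod (\<xi> (\<lambda>z. \<Sum>j<N. d j * fock_kernel \<alpha> (w j) z))"
        by (simp add: dx sum_nonneg flip: of_real_sum)
      also have "\<dots> \<le> vnorm ?X (\<lambda>z. \<Sum>j<N. d j * fock_kernel \<alpha> (w j) z)"
        using \<xi> BX[OF d] by (simp add: dual_ball_def)
      also have "\<dots> \<le> B * real N powr (1 / p)" by (rule BN[OF d])
      finally have l1: "(\<Sum>j<N. cmod (\<xi> (fock_kernel \<alpha> (w j)))) \<le> B * real N powr (1 / p)" .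
      \<comment> \<open>The uniform bound \<open>c\<close> on the values reduces the exponent
        \<open>r\<close> to 1.\<close>
      have "(\<Sum>j<N. cmod (\<xi> (fock_kernel \<alpha> (w j))) powr r) \<le> (\<Sum>j<N. c powr (r - 1) * cmod (\<xi> (fock_kernel \<alpha> (w j))))"
      proof (rule sum_mono)
        fix j
        let ?x = "cmod (\<xi> (fock_kernel \<alpha> (w j)))"
        show "?x powr r \<le> c powr (r - 1) * ?x"
        proof (cases "?x = 0")
          case False
          then have "?x powr r = ?x powr (r - 1) * ?x"
            using powr_add[of ?x "r - 1" 1] by simp
          also have "\<dots> \<le> c powr (r - 1) * ?x"
            using r \<xi>le[OF \<xi>] by (intro mult_right_mono powr_mono2) auto
          finally show ?thesis .
        qed simp
      qed
      also have "\<dots> \<le> c powr (r - 1) * (B * real N powr (1 / p))"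
        unfolding sum_distrib_left[symmetric] by (intro mult_left_mono l1) auto
      finally show ?thesis .
    qed
    define Q where "Q = C powr r * (c powr (r - 1) * B) / c0 powr r"
    have bound: "real N powr (1 - 1 / p) \<le> Q" if "N > 0" for N
    proof -
      have "real N * c0 powr r = (\<Sum>j<N. c0 powr r)" by simp
      also have "\<dots> \<le> (\<Sum>j<N. vnorm ?X (?T (fock_kernel \<alpha> (w j))) powr r)"
        using c0 r low by (intro sum_mono powr_mono2) auto
      also have "\<dots> \<le> C powr r * (c powr (r - 1) * (B * real N powr (1 / p)))"
        using B by (intro summing_le kin weak) auto
      finally have "real N \<le> Q * real N powr (1 / p)"
        using c0 by (simp add: Q_def field_simps)
      moreover have "real N = real N powr (1 - 1 / p) * real N powr (1 / p)"
        using that by (simp add: powr_add[symmetric])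
      ultimately have "real N powr (1 - 1 / p) * real N powr (1 / p) \<le> Q * real N powr (1 / p)" by simp
      then show ?thesis using that by (simp add: mult_le_cancel_right)
    qed
    \<comment> \<open>The exponent \<open>1 - 1 / p\<close> is positive because
      \<open>p > 1\<close>, so the bound by \<open>Q\<close> fails for large
      \<open>N\<close>.\<close>
    have "filterlim (\<lambda>N. real N powr (1 - 1 / p)) at_top sequentially"
      using p by (intro filterlim_compose[OF real_powr_at_top filterlim_real_sequentially]) (auto simp: field_simps)
    then have "eventually (\<lambda>N. real N powr (1 - 1 / p) > Q) sequentially"
      by (simp add: filterlim_at_top_dense)
    then have "eventually (\<lambda>N. real N powr (1 - 1 / p) > Q \<and> N > 0) sequentially"
      using eventually_gt_at_top[of 0] by eventually_elim auto
    then obtain N where "real N powr (1 - 1 / p) > Q" "N > 0"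
      unfolding eventually_sequentially by blast
    with bound[of N] show False by simp
  qed
  then show ?thesis using ab by blast
qed

theorem theorem4p4:
  fixes \<alpha> p r :: real and \<phi> :: "complex \<Rightarrow> complex"
  assumes "\<alpha> > 0" and "\<phi> holomorphic_on UNIV" and "p > 1" and "r \<ge> 1"
  shows "r_summing r (fock_space p \<alpha>) (fock_space p \<alpha>) (composition_operator \<phi>) \<longleftrightarrow>
    (\<exists>a b. cmod a < 1 \<and> (\<forall>z. \<phi> z = a * z + b))"
  using affine_composition_summing[of \<alpha> p r _ \<phi>] summing_composition_affine[of \<alpha> p r \<phi>] assms
  by auto

end
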